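(* Let $T$ be the unilateral weighted shift with bounded complex weights $\{\alpha_j\}_{j\ge1}$, where $\alpha_j\neq0$ for all $j\ge1$. If $\mathcal S(T,T^* )$ is an SI semigroup, then for each $i\ge2$ the reciprocal $1/\alpha_i$ is a product of some $\alpha_j$'s and $\bar\alpha_j$'s with indices $j\ge i$ (a finite product, repetitions allowed).
   Context: For an orthonormal basis $\{e_n\}_{n\ge1}$ of a Hilbert space $\mathcal H$, the weighted shift with weights $\{\alpha_n\}$ is the bounded operator with $Te_n=\alpha_ne_{n+1}$, $n\ge1$. $\mathcal S(T,T^* )$ is the multiplicative semigroup of all finite nonempty products of $T$ and $T^*$. An ideal of a semigroup $\mathcal S$ is a nonempty subset $J\subset\mathcal S$ with $XA,AX\in J$ for $A\in J$, $X\in\mathcal S$. $\mathcal S$ is an SI (selfadjoint-ideal) semigroup if every ideal $J$ of $\mathcal S$ satisfies $J^*=\{A^*:A\in J\}\subset J$. *)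

theory Defs
  imports "HOL-Analysis.Analysis"
begin

text \<open>
  Complex Hilbert spaces: a Banach space whose norm comes from a complex inner product, linear in
  the first argument. Positive definiteness is the last axiom, since a norm is positive definite.
\<close>

class complex_hilbert_space = banach +
  fixes scaleC :: "complex \<Rightarrow> 'a \<Rightarrow> 'a" (infixr "*\<^sub>C" 75)
    and cinner :: "'a \<Rightarrow> 'a \<Rightarrow> complex"
  assumes scaleC_add_right: "a *\<^sub>C (x + y) = a *\<^sub>C x + a *\<^sub>C y"
    and scaleC_add_left: "(a + b) *\<^sub>C x = a *\<^sub>C x + b *\<^sub>C x"
    and scaleC_scaleC: "a *\<^sub>C (b *\<^sub>C x) = (a * b) *\<^sub>C x"
    and scaleC_one: "1 *\<^sub>C x = x"
    and scaleR_scaleC: "r *\<^sub>R x = complex_of_real r *\<^sub>C x"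
    and cinner_commute: "cinner x y = cnj (cinner y x)"
    and cinner_add_left: "cinner (x + y) z = cinner x z + cinner y z"
    and cinner_scaleC_left: "cinner (a *\<^sub>C x) y = a * cinner x y"
    and cinner_self: "cinner x x = complex_of_real ((norm x)\<^sup>2)"

definition bounded_operator :: "('h::complex_hilbert_space \<Rightarrow> 'h) \<Rightarrow> bool" where
  "bounded_operator T \<longleftrightarrow> bounded_linear T \<and> (\<forall>c x. T (c *\<^sub>C x) = c *\<^sub>C T x)"

text \<open>For a bounded operator the adjoint exists uniquely; otherwise the value may be arbitrary.\<close>

definition cadjoint :: "('h::complex_hilbert_space \<Rightarrow> 'h) \<Rightarrow> 'h \<Rightarrow> 'h" where
  "cadjoint T = (THE S. \<forall>x y. cinner (T x) y = cinner x (S y))"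

text \<open>Sequences are indexed from 1; the values at index 0 play no role.\<close>

definition orthonormal_basis :: "(nat \<Rightarrow> 'h::complex_hilbert_space) \<Rightarrow> bool" where
  "orthonormal_basis e \<longleftrightarrow>
     (\<forall>m\<ge>1. \<forall>n\<ge>1. cinner (e m) (e n) = (if m = n then 1 else 0)) \<and>
     closure (module.span scaleC (e ` {1..})) = UNIV"

definition weighted_shift ::
  "(nat \<Rightarrow> 'h::complex_hilbert_space) \<Rightarrow> (nat \<Rightarrow> complex) \<Rightarrow> ('h \<Rightarrow> 'h) \<Rightarrow> bool" where
  "weighted_shift e \<alpha> T \<longleftrightarrow> bounded_operator T \<and> (\<forall>n\<ge>1. T (e n) = \<alpha> n *\<^sub>C e (n + 1))"

definition generated_semigroup :: "('h::complex_hilbert_space \<Rightarrow> 'h) \<Rightarrow> ('h \<Rightarrow> 'h) set" where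
  "generated_semigroup T = {foldr (\<circ>) ws id |ws. ws \<noteq> [] \<and> set ws \<subseteq> {T, cadjoint T}}"

definition semigroup_ideal :: "('h \<Rightarrow> 'h) set \<Rightarrow> ('h \<Rightarrow> 'h) set \<Rightarrow> bool" where
  "semigroup_ideal S J \<longleftrightarrow>
     J \<noteq> {} \<and> J \<subseteq> S \<and> (\<forall>A\<in>J. \<forall>X\<in>S. X \<circ> A \<in> J \<and> A \<circ> X \<in> J)"

definition SI_semigroup :: "('h::complex_hilbert_space \<Rightarrow> 'h) set \<Rightarrow> bool" where
  "SI_semigroup S \<longleftrightarrow> (\<forall>J. semigroup_ideal S J \<longrightarrow> cadjoint ` J \<subseteq> J)"

end

theory Submission imports Defs begin

text \<open>
  The words in \<open>T\<close> and \<open>T\<^sup>*\<close> that contain the letter \<open>T\<close> form an ideal, so \<open>T\<^sup>*\<close> itself equals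
  such a word. A word moves each basis vector along a lattice path whose steps carry the weights,
  and a comparison with \<open>T\<^sup>*\<close> on \<open>e\<^sub>2\<close> shows that this path ends one level below its start and never
  goes further down. If the path climbs back from its lowest level, then starting it at \<open>e\<^sub>i\<^sub>+\<^sub>1\<close> gives
  \<open>cnj \<alpha>\<^sub>i = \<alpha>\<^sub>i cnj \<alpha>\<^sub>i \<cdots>\<close> with all indices \<open>\<ge> i\<close>. Otherwise it is a nonempty loop followed by one
  step down, and starting it at \<open>e\<^sub>i\<close> gives \<open>cnj \<alpha>\<^sub>i\<^sub>-\<^sub>1 = (\<alpha>\<^sub>i \<cdots>) cnj \<alpha>\<^sub>i\<^sub>-\<^sub>1\<close>.
\<close>

section \<open>Inner products and adjoints\<close>

interpretation scaleC: module "scaleC :: complex \<Rightarrow> 'a::complex_hilbert_space \<Rightarrow> 'a"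
  by unfold_locales
    (simp_all add: scaleC_add_right scaleC_add_left scaleC_scaleC scaleC_one)

lemma cinner_add_right: "cinner x (y + z) = cinner x y + cinner x z"
  by (metis cinner_commute cinner_add_left complex_cnj_add)

lemma cinner_scaleC_right: "cinner x (a *\<^sub>C y) = cnj a * cinner x y"
  by (metis cinner_commute cinner_scaleC_left complex_cnj_mult)

lemma cinner_scaleR_left: "cinner (r *\<^sub>R x) y = r * cinner x y"
  by (simp add: scaleR_scaleC cinner_scaleC_left)

lemma cinner_zero_left [simp]: "cinner 0 y = 0"
  using cinner_scaleC_left[of 0 0 y] by simp

lemma cinner_zero_right [simp]: "cinner x 0 = 0"
  using cinner_scaleC_right[of x 0 0] by simp

lemma cinner_diff_right: "cinner x (y - z) = cinner x y - cinner x z"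
  using cinner_add_right[of x "y - z" z] by simp

lemma cinner_extensionality:
  assumes "\<And>x. cinner x y = cinner x z"
  shows "y = z"
  using cinner_self[of "y - z"] assms by (simp add: cinner_diff_right)

lemma norm_add_square:
  "(norm (x + y))\<^sup>2 = (norm x)\<^sup>2 + 2 * Re (cinner x y) + (norm y)\<^sup>2"
proof -
  have "Re (cinner y x) = Re (cinner x y)"
    by (metis cinner_commute cnj.simps(1))
  moreover have "Re (cinner (x + y) (x + y)) = 
      Re (cinner x x) + Re (cinner x y) + Re (cinner y x) + Re (cinner y y)"
    by (simp add: cinner_add_left cinner_add_right)
  ultimately show ?thesis
    by (simp add: cinner_self)
qed

text \<open>The norm comes with its triangle inequality, so Cauchy-Schwarz follows from it: square
  it and compare with \<open>norm_add_square\<close>.\<close>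

lemma abs_Re_cinner_le: "\<bar>Re (cinner x y)\<bar> \<le> norm x * norm y"
proof -
  have *: "Re (cinner u y) \<le> norm u * norm y" for u
    using norm_add_square[of u y] power_mono[OF norm_triangle_ineq[of u y] norm_ge_zero, of 2]
    by (simp add: power2_sum)
  show ?thesis
    using *[of x] *[of "- x"] cinner_scaleR_left[of "-1" x y] by simp
qed

section \<open>Riesz representation and existence of adjoints\<close>

lemma bounded_linear_Re_cinner: "bounded_linear (\<lambda>x. Re (cinner x y))"
proof (rule bounded_linear_intro)
  show "norm (Re (cinner x y)) \<le> norm x * norm y" for x
    using abs_Re_cinner_le by simp
qed (simp_all add: cinner_add_left cinner_scaleR_left)

text \<open>The representing vector is the minimiser of \<open>\<parallel>x\<parallel>\<^sup>2 - 2 f x\<close>.\<close>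

lemma riesz_representation:
  fixes f :: "'h::complex_hilbert_space \<Rightarrow> real"
  assumes f: "bounded_linear f"
  shows "\<exists>z. \<forall>x. f x = Re (cinner x z)"
proof -
  interpret bounded_linear f by fact
  define q where "q x = (norm x)\<^sup>2 - 2 * f x" for x
  obtain K where K: "\<And>x. norm (f x) \<le> norm x * K"
    using bounded by blast
  have "- K\<^sup>2 \<le> q x" for x
  proof -
    have "f x \<le> norm x * K"
      using K[of x] by simp
    moreover have "0 \<le> (norm x - K)\<^sup>2"
      by simp
    ultimately show ?thesis
      by (simp add: q_def power2_diff)
  qed
  then have bdd: "bdd_below (range q)"
    by (rule bdd_belowI2)
  define m where "m = Inf (range q)"
  have m_le: "m \<le> q x" for x
    unfolding m_def by (rule cInf_lower[OF _ bdd]) simp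
  have "\<exists>x. q x < m + 1 / real (Suc n)" for n
    using cInf_lessD[of "range q" "m + 1 / real (Suc n)"] by (auto simp: m_def)
  then obtain u where u: "\<And>n. q (u n) < m + 1 / real (Suc n)"
    by metis
  \<comment> \<open>The parallelogram law, with \<open>q\<close> at the midpoint bounded below by
    \<open>m\<close>, makes minimising sequences Cauchy.\<close>
  have norm_diff_le: "(norm (x - y))\<^sup>2 \<le> 2 * (q x - m) + 2 * (q y - m)" for x y
  proof -
    have f_eq: "f ((1/2) *\<^sub>R (x + y)) = (f x + f y) / 2"
      by (simp add: scaleR add)
    have "(norm ((1/2) *\<^sub>R (x + y)))\<^sup>2 = (norm (x + y))\<^sup>2 / 4"
      by (simp add: power_divide)
    then have "4 * m \<le> (norm (x + y))\<^sup>2 - 4 * (f x + f y)"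
      using m_le[of "(1/2) *\<^sub>R (x + y)"] unfolding q_def f_eq by argo
    moreover have "(norm (x + y))\<^sup>2 + (norm (x - y))\<^sup>2 = 2 * (norm x)\<^sup>2 + 2 * (norm y)\<^sup>2"
      using norm_add_square[of x y] norm_add_square[of x "- y"]
        cinner_diff_right[of x 0 y] by simp
    ultimately show ?thesis
      by (simp add: q_def)
  qed
  have "Cauchy u"
  proof (rule CauchyI)
    fix \<epsilon> :: real
    assume "0 < \<epsilon>"
    then obtain N where N: "inverse (real (Suc N)) < \<epsilon>\<^sup>2 / 4"
      using reals_Archimedean[of "\<epsilon>\<^sup>2 / 4"] by auto
    have near: "q (u n) - m < \<epsilon>\<^sup>2 / 4" if "N \<le> n" for n
    proof -
      have "1 / real (Suc n) \<le> inverse (real (Suc N))"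
        using that by (simp add: field_simps)
      then show ?thesis
        using u[of n] N by linarith
    qed
    have "norm (u k - u n) < \<epsilon>" if "N \<le> k" "N \<le> n" for k n
    proof (rule power2_less_imp_less)
      show "(norm (u k - u n))\<^sup>2 < \<epsilon>\<^sup>2"
        using norm_diff_le[of "u k" "u n"] near[OF that(1)] near[OF that(2)] by argo
    qed (use \<open>0 < \<epsilon>\<close> in simp)
    then show "\<exists>M. \<forall>k\<ge>M. \<forall>n\<ge>M. norm (u k - u n) < \<epsilon>"
      by blast
  qed
  then obtain z where z: "u \<longlonglongrightarrow> z"
    using Cauchy_convergent convergent_def by blast
  have "(\<lambda>n. q (u n)) \<longlonglongrightarrow> q z"
    unfolding q_def by (intro tendsto_intros tendsto z)
  moreover have "(\<lambda>n. m + 1 / real (Suc n)) \<longlonglongrightarrow> m + 0"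
    by (intro tendsto_add tendsto_const LIMSEQ_Suc[OF lim_1_over_n])
  ultimately have qz: "q z \<le> m"
    using u by (intro LIMSEQ_le[where X = "\<lambda>n. q (u n)"]) (auto intro: less_imp_le)
  have "f x = Re (cinner x z)" for x
  proof (rule ccontr)
    assume neq: "f x \<noteq> Re (cinner x z)"
    define d where "d = f x - Re (cinner x z)"
    have quad: "0 \<le> t\<^sup>2 * (norm x)\<^sup>2 - 2 * t * d" for t
    proof -
      have "q z \<le> q (t *\<^sub>R x + z)"
        using qz m_le[of "t *\<^sub>R x + z"] by simp
      then show ?thesis
        using norm_add_square[of "t *\<^sub>R x" z]
        by (simp add: q_def d_def add scaleR cinner_scaleR_left power_mult_distrib algebra_simps)
    qed
    \<comment> \<open>This \<open>t\<close> turns the bound \<open>quad\<close> into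
      \<open>- (t\<^sup>2 * ((norm x)\<^sup>2 + 2))\<close>; the summand 1 keeps the denominator
      positive when \<open>x = 0\<close>.\<close>
    define t where "t = d / ((norm x)\<^sup>2 + 1)"
    have pos: "(norm x)\<^sup>2 + 1 > 0"
      by (simp add: add_nonneg_pos)
    have d_eq: "d = t * ((norm x)\<^sup>2 + 1)"
      using pos by (simp add: t_def)
    then have "t \<noteq> 0"
      using neq by (auto simp: d_def)
    have "0 \<le> - (t\<^sup>2 * ((norm x)\<^sup>2 + 2))"
      using quad[of t] unfolding d_eq by (simp add: algebra_simps power2_eq_square)
    moreover have "0 < t\<^sup>2 * ((norm x)\<^sup>2 + 2)"
      using \<open>t \<noteq> 0\<close> by (simp add: add_nonneg_pos)
    ultimately show False
      by linarith
  qed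
  then show ?thesis
    by blast
qed

lemma cinner_cadjoint:
  assumes T: "bounded_operator T"
  shows "cinner (T x) y = cinner x (cadjoint T y)"
proof -
  have linT: "bounded_linear T" and scaleT: "\<And>c x. T (c *\<^sub>C x) = c *\<^sub>C T x"
    using T by (auto simp: bounded_operator_def)
  have "\<exists>z. \<forall>x. cinner (T x) y = cinner x z" for y
  proof -
    obtain z where z: "\<And>x. Re (cinner (T x) y) = Re (cinner x z)"
      using riesz_representation[OF bounded_linear_compose[OF bounded_linear_Re_cinner linT]]
      by meson
    \<comment> \<open>Testing with \<open>\<i> *\<^sub>C x\<close> recovers the imaginary
      part.\<close>
    have "cinner (T x) y = cinner x z" for x
      using z[of x] z[of "\<i> *\<^sub>C x"] by (simp add: complex_eq_iff scaleT cinner_scaleC_left)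
    then show ?thesis
      by blast
  qed
  then obtain S where S: "\<forall>x y. cinner (T x) y = cinner x (S y)"
    by metis
  have "cadjoint T = S"
    unfolding cadjoint_def
  proof (rule the_equality)
    show "R = S" if "\<forall>x y. cinner (T x) y = cinner x (R y)" for R
      using that S by (intro ext cinner_extensionality) metis
  qed (rule S)
  then show ?thesis
    using S by simp
qed

lemma cadjoint_scaleC:
  assumes "bounded_operator T"
  shows "cadjoint T (c *\<^sub>C x) = c *\<^sub>C cadjoint T x"
  by (rule cinner_extensionality)
    (simp add: cinner_scaleC_right flip: cinner_cadjoint[OF assms])

section \<open>Orthonormal bases and the adjoint of a weighted shift\<close>

lemma orthonormal_basis_extensionality:
  assumes e: "orthonormal_basis e" and eq: "\<And>m. 1 \<le> m \<Longrightarrow> cinner (e m) y = cinner (e m) z"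
  shows "y = z"
proof -
  define v where "v = y - z"
  have "cinner x v = 0" if "x \<in> module.span scaleC (e ` {1..})" for x
    using that
  proof (induct rule: scaleC.span_induct)
    show "scaleC.subspace {x. cinner x v = 0}"
      by (simp add: scaleC.subspace_def cinner_add_left cinner_scaleC_left)
  qed (auto simp: v_def cinner_diff_right eq)
  then have "module.span scaleC (e ` {1..}) \<subseteq> {x. Re (cinner x v) = 0}"
    by auto
  \<comment> \<open>The real part suffices, because \<open>cinner v v\<close> is real.\<close>
  moreover have "closed {x. Re (cinner x v) = 0}"
    by (intro closed_Collect_eq linear_continuous_on bounded_linear_Re_cinner continuous_on_const)
  ultimately have "closure (module.span scaleC (e ` {1..})) \<subseteq> {x. Re (cinner x v) = 0}"
    by (rule closure_minimal)
  then have "Re (cinner v v) = 0"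
    using e by (auto simp: orthonormal_basis_def)
  then show ?thesis
    by (simp add: cinner_self v_def)
qed

lemma cadjoint_weighted_shift:
  assumes e: "orthonormal_basis e" and T: "weighted_shift e \<alpha> T"
  shows "cadjoint T (e 1) = 0"
    and "1 \<le> n \<Longrightarrow> cadjoint T (e (n + 1)) = cnj (\<alpha> n) *\<^sub>C e n"
proof -
  have bT: "bounded_operator T" and shift: "\<And>n. 1 \<le> n \<Longrightarrow> T (e n) = \<alpha> n *\<^sub>C e (n + 1)"
    using T by (auto simp: weighted_shift_def)
  have orth: "cinner (e m) (e k) = (if m = k then 1 else 0)" if "1 \<le> m" "1 \<le> k" for m k
    using e that by (simp add: orthonormal_basis_def)
  show "cadjoint T (e 1) = 0"
    by (rule orthonormal_basis_extensionality[OF e])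
      (simp add: shift cinner_scaleC_left orth flip: cinner_cadjoint[OF bT])
  show "cadjoint T (e (n + 1)) = cnj (\<alpha> n) *\<^sub>C e n" if "1 \<le> n"
    by (rule orthonormal_basis_extensionality[OF e])
      (use that in \<open>simp add: shift cinner_scaleC_left cinner_scaleC_right orth flip: cinner_cadjoint[OF bT]\<close>)
qed

section \<open>Lattice paths\<close>

text \<open>
  A word is a list of letters, \<^const>\<open>True\<close> for \<open>T\<close> and \<^const>\<open>False\<close> for its adjoint. Words act
  like composed operators, so the last letter is the first step of the path.
\<close>

fun height :: "bool list \<Rightarrow> int" where
  "height [] = 0"
| "height (b # bs) = (if b then height bs + 1 else height bs - 1)"

text \<open>A step between the levels \<open>h\<close> and \<open>h + 1\<close>, in either direction, is labelled with \<open>h\<close>.\<close>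

fun steps :: "bool list \<Rightarrow> (bool \<times> int) list" where
  "steps [] = []"
| "steps (b # bs) = (b, if b then height bs else height bs - 1) # steps bs"

text \<open>A path starts at level 0 and moves by unit steps, so it must cross from 0 to -1 to end
  below 0.\<close>

lemma down_step_if_height_neg: "height bs < 0 \<Longrightarrow> (False, -1) \<in> set (steps bs)"
proof (induct bs)
  case (Cons b bs)
  show ?case
  proof (cases "height bs < 0")
    case False
    then have "height bs = 0" "\<not> b"
      using Cons.prems by (auto split: if_splits)
    then show ?thesis
      by simp
  qed (use Cons.hyps in simp)
qed simp

lemma first_step: "bs \<noteq> [] \<Longrightarrow> (True, 0) \<in> set (steps bs) \<or> (False, -1) \<in> set (steps bs)"
proof (induct bs)
  case (Cons b bs)
  then show ?case
    by (cases bs) auto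
qed simp

text \<open>At level -1 the hypotheses forbid both a further descent and a climb back. Hence a step
  into that level is the last one, which is the head of the list.\<close>

lemma path_without_return:
  assumes "\<And>b h. (b, h) \<in> set (steps bs) \<Longrightarrow> -1 \<le> h" "(True, -1) \<notin> set (steps bs)"
  shows "height bs \<ge> 0 \<and> (False, -1) \<notin> set (steps bs) \<or>
    (\<exists>cs. bs = False # cs \<and> height cs = 0 \<and> (False, -1) \<notin> set (steps cs))"
  using assms
proof (induct bs)
  case (Cons b bs)
  have low: "-1 \<le> (if b then height bs else height bs - 1)"
    using Cons.prems(1)[of b] by simp
  have "height bs \<ge> 0 \<and> (False, -1) \<notin> set (steps bs) \<or>
      (\<exists>cs. bs = False # cs \<and> height cs = 0 \<and> (False, -1) \<notin> set (steps cs))"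
    by (rule Cons.hyps) (use Cons.prems in auto)
  then show ?case
  proof (elim disjE conjE exE)
    assume "height bs \<ge> 0" "(False, -1) \<notin> set (steps bs)"
    then show ?thesis
      by (cases b; cases "height bs = 0") auto
  next
    fix cs
    assume "bs = False # cs" "height cs = 0"
    then show ?thesis
      using low Cons.prems(2) by (cases b) auto
  qed
qed simp

section \<open>Words in a weighted shift and its adjoint\<close>

definition letter :: "('h::complex_hilbert_space \<Rightarrow> 'h) \<Rightarrow> bool \<Rightarrow> 'h \<Rightarrow> 'h" where
  "letter T b = (if b then T else cadjoint T)"

text \<open>Spelling is kept apart from the operator: height and steps depend on the letters, and
  different words may give the same operator.\<close>

definition word :: "('h::complex_hilbert_space \<Rightarrow> 'h) \<Rightarrow> bool list \<Rightarrow> 'h \<Rightarrow> 'h" where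
  "word T bs = foldr (\<circ>) (map (letter T) bs) id"

lemma word_Nil [simp]: "word T [] = id"
  and word_Cons [simp]: "word T (b # bs) = letter T b \<circ> word T bs"
  by (simp_all add: word_def)

lemma word_append: "word T (bs @ cs) = word T bs \<circ> word T cs"
  by (induct bs) (auto simp: comp_assoc)

lemma generated_semigroup_eq: "generated_semigroup T = {word T bs |bs. bs \<noteq> []}"
proof (intro equalityI subsetI)
  fix X
  assume "X \<in> generated_semigroup T"
  then obtain ws where ws: "X = foldr (\<circ>) ws id" "ws \<noteq> []" "set ws \<subseteq> {T, cadjoint T}"
    by (auto simp: generated_semigroup_def)
  have "map (letter T) (map (\<lambda>w. w = T) ws) = ws"
    using ws(3) by (induct ws) (auto simp: letter_def)
  then show "X \<in> {word T bs |bs. bs \<noteq> []}"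
    using ws(1,2) by (intro CollectI exI[of _ "map (\<lambda>w. w = T) ws"]) (simp add: word_def)
next
  fix X
  assume "X \<in> {word T bs |bs. bs \<noteq> []}"
  then obtain bs where bs: "X = word T bs" "bs \<noteq> []"
    by blast
  have "set (map (letter T) bs) \<subseteq> {T, cadjoint T}"
    by (auto simp: letter_def)
  then show "X \<in> generated_semigroup T"
    using bs unfolding generated_semigroup_def word_def by blast
qed

text \<open>The word \<open>[False]\<close> satisfies the equation trivially; the content is a
  spelling that contains \<open>T\<close>, supplied by the ideal \<open>J\<close>.\<close>

lemma SI_semigroup_cadjoint_eq_word:
  assumes "SI_semigroup (generated_semigroup T)"
  obtains bs where "True \<in> set bs" "cadjoint T = word T bs"
proof -
  define J where "J = {word T bs |bs. True \<in> set bs}"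
  have T: "T \<in> J"
    unfolding J_def by (intro CollectI exI[of _ "[True]"]) (simp add: letter_def)
  have "X \<circ> A \<in> J \<and> A \<circ> X \<in> J" if A: "A \<in> J" and X: "X \<in> generated_semigroup T" for A X
  proof -
    obtain bs cs where "A = word T bs" "True \<in> set bs" "X = word T cs"
      using A X by (auto simp: J_def generated_semigroup_eq)
    then have "X \<circ> A = word T (cs @ bs)" "A \<circ> X = word T (bs @ cs)"
        "True \<in> set (cs @ bs)" "True \<in> set (bs @ cs)"
      by (simp_all add: word_append)
    then show ?thesis
      unfolding J_def by blast
  qed
  moreover have "J \<subseteq> generated_semigroup T"
    by (auto simp: J_def generated_semigroup_eq)
  ultimately have "semigroup_ideal (generated_semigroup T) J"
    using T by (auto simp: semigroup_ideal_def)
  then have "cadjoint T \<in> J"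
    using assms T by (auto simp: SI_semigroup_def)
  then show ?thesis
    using that by (auto simp: J_def)
qed

text \<open>
  Extending basis and weights by zero to all integers makes \<open>T e\<^sub>k = \<alpha>\<^sub>k e\<^sub>k\<^sub>+\<^sub>1\<close> and its adjoint
  version hold for every \<open>k\<close>; a path that falls off the basis then has weight zero.
\<close>

definition zero_extend :: "(nat \<Rightarrow> 'a::zero) \<Rightarrow> int \<Rightarrow> 'a" where
  "zero_extend f k = (if 1 \<le> k then f (nat k) else 0)"

text \<open>Labels are relative to the start, so \<open>n\<close> is the starting index. A label is
  the lower end of its step, hence both directions use the same weight up to conjugation.\<close>

definition step_weight :: "(nat \<Rightarrow> complex) \<Rightarrow> int \<Rightarrow> bool \<times> int \<Rightarrow> complex" where
  "step_weight \<alpha> n s =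
     (if fst s then zero_extend \<alpha> (n + snd s) else cnj (zero_extend \<alpha> (n + snd s)))"

lemma step_weight_eq_zero: "n + h < 1 \<Longrightarrow> step_weight \<alpha> n (b, h) = 0"
  by (simp add: step_weight_def zero_extend_def)

lemma letter_zero_extend:
  assumes e: "orthonormal_basis e" and T: "weighted_shift e \<alpha> T"
  shows "letter T True (zero_extend e k) = zero_extend \<alpha> k *\<^sub>C zero_extend e (k + 1)"
    and "letter T False (zero_extend e k) = cnj (zero_extend \<alpha> (k - 1)) *\<^sub>C zero_extend e (k - 1)"
proof -
  have bT: "bounded_operator T" and shift: "\<And>n. 1 \<le> n \<Longrightarrow> T (e n) = \<alpha> n *\<^sub>C e (n + 1)"
    using T by (auto simp: weighted_shift_def)
  have T0: "T 0 = 0" and adj0: "cadjoint T 0 = 0"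
    using bT cadjoint_scaleC[OF bT, of 0 0] by (auto simp: bounded_operator_def bounded_linear.linear linear_0)
  have "nat (k + 1) = nat k + 1" if "1 \<le> k"
    using that by simp
  then show "letter T True (zero_extend e k) = zero_extend \<alpha> k *\<^sub>C zero_extend e (k + 1)"
    using shift[of "nat k"] T0 by (auto simp: letter_def zero_extend_def)
  consider "k < 1" | "k = 1" | "2 \<le> k"
    by linarith
  then show "letter T False (zero_extend e k) = cnj (zero_extend \<alpha> (k - 1)) *\<^sub>C zero_extend e (k - 1)"
  proof cases
    case 3
    then have "nat k = nat (k - 1) + 1" "1 \<le> nat (k - 1)"
      by auto
    then show ?thesis
      using cadjoint_weighted_shift(2)[OF e T, of "nat (k - 1)"] 3
      by (simp add: letter_def zero_extend_def)
  qed (use cadjoint_weighted_shift(1)[OF e T] adj0 in \<open>simp_all add: letter_def zero_extend_def\<close>)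
qed

lemma letter_scaleC:
  assumes "bounded_operator T"
  shows "letter T b (c *\<^sub>C x) = c *\<^sub>C letter T b x"
  using assms cadjoint_scaleC[OF assms] by (simp add: letter_def bounded_operator_def)

lemma word_zero_extend:
  assumes e: "orthonormal_basis e" and T: "weighted_shift e \<alpha> T"
  shows "word T bs (zero_extend e n) =
    prod_list (map (step_weight \<alpha> n) (steps bs)) *\<^sub>C zero_extend e (n + height bs)"
proof (induct bs)
  case (Cons b bs)
  have bT: "bounded_operator T"
    using T by (simp add: weighted_shift_def)
  show ?case
    using letter_zero_extend[OF e T, of "n + height bs"]
    by (cases b) (simp_all add: Cons letter_scaleC[OF bT] step_weight_def algebra_simps)
qed simp

text \<open>Pair both sides with the basis vector at \<open>k\<close>. A priori \<open>l\<close> may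
  be off the basis and \<open>d\<close> zero; \<open>c \<noteq> 0\<close> excludes both.\<close>

lemma scaleC_basis_eq:
  assumes e: "orthonormal_basis e" and "1 \<le> k" "c \<noteq> 0"
    and eq: "c *\<^sub>C zero_extend e k = d *\<^sub>C zero_extend e l"
  shows "k = l \<and> c = d"
proof -
  have orth: "cinner (e m) (e n) = (if m = n then 1 else 0)" if "1 \<le> m" "1 \<le> n" for m n
    using e that by (simp add: orthonormal_basis_def)
  have k: "cinner (zero_extend e k) (zero_extend e k) = 1"
    using \<open>1 \<le> k\<close> by (simp add: zero_extend_def orth)
  have "cinner (zero_extend e l) (zero_extend e k) = (if l = k then 1 else 0)"
    using \<open>1 \<le> k\<close> by (auto simp: zero_extend_def orth nat_eq_iff)
  then have "c = d * (if l = k then 1 else 0)"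
    using arg_cong[OF eq, of "\<lambda>x. cinner x (zero_extend e k)"] k
    by (simp add: cinner_scaleC_left)
  then show ?thesis
    using \<open>c \<noteq> 0\<close> by (auto split: if_splits)
qed

lemma reciprocal_eq_prod_list:
  assumes "\<alpha> i \<noteq> 0" "1 \<le> i"
    and idx: "\<And>b h. (b, h) \<in> set L \<Longrightarrow> int i \<le> n + h"
    and prod: "\<alpha> i * prod_list (map (step_weight \<alpha> n) L) = 1"
  shows "\<exists>xs. xs \<noteq> [] \<and> set xs \<subseteq> {\<alpha> j |j. j \<ge> i} \<union> {cnj (\<alpha> j) |j. j \<ge> i} \<and>
           1 / \<alpha> i = prod_list xs"
proof (cases "L = []")
  \<comment> \<open>An empty product forces the weight to be 1, so it is its own reciprocal and
    gives a nonempty list.\<close>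
  case True
  then have "\<alpha> i = 1"
    using prod by simp
  then show ?thesis
    by (intro exI[of _ "[\<alpha> i]"]) auto
next
  case False
  have "step_weight \<alpha> n (b, h) \<in> {\<alpha> j |j. j \<ge> i} \<union> {cnj (\<alpha> j) |j. j \<ge> i}"
    if "(b, h) \<in> set L" for b h
  proof -
    have "i \<le> nat (n + h)" "1 \<le> n + h"
      using idx[OF that] \<open>1 \<le> i\<close> by linarith+
    then show ?thesis
      by (auto simp: step_weight_def zero_extend_def)
  qed
  then have "set (map (step_weight \<alpha> n) L) \<subseteq> {\<alpha> j |j. j \<ge> i} \<union> {cnj (\<alpha> j) |j. j \<ge> i}"
    by (simp add: image_subset_iff split_paired_all)
  moreover have "1 / \<alpha> i = prod_list (map (step_weight \<alpha> n) L)"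
    using prod \<open>\<alpha> i \<noteq> 0\<close> by (simp add: field_simps)
  ultimately show ?thesis
    using False by (intro exI[of _ "map (step_weight \<alpha> n) L"]) simp
qed

lemma prod_list_map_remove1:
  fixes f :: "'a \<Rightarrow> 'b::comm_monoid_mult"
  shows "x \<in> set xs \<Longrightarrow> prod_list (map f xs) = f x * prod_list (map f (remove1 x xs))"
  by (induct xs) (auto simp: ac_simps)

section \<open>Cancellation of weights along the path\<close>

theorem theorem3p6:
  fixes e :: "nat \<Rightarrow> 'h::complex_hilbert_space"
    and \<alpha> :: "nat \<Rightarrow> complex"
    and T :: "'h \<Rightarrow> 'h"
  assumes "orthonormal_basis e"
    and "bounded (\<alpha> ` {1..})"
    and "\<forall>j\<ge>1. \<alpha> j \<noteq> 0"
    and "weighted_shift e \<alpha> T"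
    and "SI_semigroup (generated_semigroup T)"
  shows "\<forall>i\<ge>2. \<exists>xs. xs \<noteq> [] \<and> set xs \<subseteq> {\<alpha> j |j. j \<ge> i} \<union> {cnj (\<alpha> j) |j. j \<ge> i} \<and>
           1 / \<alpha> i = prod_list xs"
proof (intro allI impI)
  fix i :: nat
  assume i: "2 \<le> i"
  obtain bs where bs: "True \<in> set bs" "cadjoint T = word T bs"
    using SI_semigroup_cadjoint_eq_word[OF assms(5)] .
  have nz: "\<alpha> j \<noteq> 0" if "1 \<le> j" for j
    using assms(3) that by simp
  \<comment> \<open>One word serves all starting points: its height is fixed, while the weight
    identity varies with \<open>n\<close>.\<close>
  have compare: "n - 1 = n + height bs \<and>
      cnj (\<alpha> (nat (n - 1))) = prod_list (map (step_weight \<alpha> n) (steps bs))" if n: "2 \<le> n" for n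
  proof (rule scaleC_basis_eq[OF assms(1)])
    have "zero_extend \<alpha> (n - 1) = \<alpha> (nat (n - 1))"
      using n by (simp add: zero_extend_def)
    then show "cnj (\<alpha> (nat (n - 1))) *\<^sub>C zero_extend e (n - 1) =
        prod_list (map (step_weight \<alpha> n) (steps bs)) *\<^sub>C zero_extend e (n + height bs)"
      using letter_zero_extend(2)[OF assms(1,4), of n] word_zero_extend[OF assms(1,4), of bs n] bs(2)
      by (simp add: letter_def)
  qed (use n nz in auto)
  have height: "height bs = -1"
    using compare[of 2] by simp
  have low: "-1 \<le> h" if "(b, h) \<in> set (steps bs)" for b h
  proof (rule ccontr)
    assume "\<not> -1 \<le> h"
    \<comment> \<open>Starting at 2, a step labelled below -1 has index at most 0 and weight zero,
      whereas the product is the conjugate of \<open>\<alpha> 1\<close>.\<close>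
    then have "0 \<in> set (map (step_weight \<alpha> 2) (steps bs))"
      using that step_weight_eq_zero[of 2 h \<alpha> b] by force
    then have "prod_list (map (step_weight \<alpha> 2) (steps bs)) = 0"
      by (simp only: prod_list_zero_iff)
    then show False
      using compare[of 2] nz[of 1] by simp
  qed
  show "\<exists>xs. xs \<noteq> [] \<and> set xs \<subseteq> {\<alpha> j |j. j \<ge> i} \<union> {cnj (\<alpha> j) |j. j \<ge> i} \<and>
           1 / \<alpha> i = prod_list xs"
  proof (cases "(True, -1) \<in> set (steps bs)")
    case True
    \<comment> \<open>From \<open>int i + 1\<close>, the two crossings labelled -1 contribute
      \<open>\<alpha> i\<close> and its conjugate. The conjugate cancels against the weight of the
      adjoint; the remaining indices are at least \<open>i\<close>.\<close>
    define L where "L = remove1 (False, -1) (remove1 (True, -1) (steps bs))"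
    have down: "(False, -1) \<in> set (remove1 (True, -1) (steps bs))"
      using down_step_if_height_neg[of bs] height by (simp add: in_set_remove1)
    have "prod_list (map (step_weight \<alpha> (int i + 1)) (steps bs)) =
        \<alpha> i * (cnj (\<alpha> i) * prod_list (map (step_weight \<alpha> (int i + 1)) L))"
      using i
      by (simp add: prod_list_map_remove1[OF True] prod_list_map_remove1[OF down]
          L_def step_weight_def zero_extend_def)
    then have "cnj (\<alpha> i) = \<alpha> i * (cnj (\<alpha> i) * prod_list (map (step_weight \<alpha> (int i + 1)) L))"
      using compare[of "int i + 1"] i by simp
    then have "\<alpha> i * prod_list (map (step_weight \<alpha> (int i + 1)) L) = 1"
      using nz[of i] i by simp
    moreover have "int i \<le> int i + 1 + h" if "(b, h) \<in> set L" for b h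
    proof -
      have "(b, h) \<in> set (steps bs)"
        using that unfolding L_def by (meson notin_set_remove1)
      then show ?thesis
        using low by fastforce
    qed
    ultimately show ?thesis
      using nz i by (intro reciprocal_eq_prod_list) auto
  next
    case False
    then obtain cs where cs: "bs = False # cs" "height cs = 0" "(False, -1) \<notin> set (steps cs)"
      using path_without_return[of bs] low height by auto
    have nonneg: "0 \<le> h" if "(b, h) \<in> set (steps cs)" for b h
    proof -
      have "-1 \<le> h" "(b, h) \<noteq> (True, -1)" "(b, h) \<noteq> (False, -1)"
        using that low[of b h] False cs by auto
      then show ?thesis
        by (cases b) auto
    qed
    \<comment> \<open>The letter \<open>T\<close> in \<open>bs\<close> makes \<open>cs\<close>
      nonempty, and its first step cannot go down.\<close>
    have up: "(True, 0) \<in> set (steps cs)"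
      using first_step[of cs] bs(1) cs by (cases "cs = []") auto
    define L where "L = remove1 (True, 0) (steps cs)"
    \<comment> \<open>From \<open>int i\<close>, the final descent has the conjugate of
      \<open>\<alpha> (i - 1)\<close> as weight, nonzero since \<open>2 \<le> i\<close>. It cancels
      and leaves the loop \<open>cs\<close> with product 1.\<close>
    have "prod_list (map (step_weight \<alpha> (int i)) (steps bs)) =
        cnj (\<alpha> (nat (int i - 1))) * (\<alpha> i * prod_list (map (step_weight \<alpha> (int i)) L))"
      using i cs(1,2)
      by (simp add: prod_list_map_remove1[OF up] L_def step_weight_def zero_extend_def)
    then have "cnj (\<alpha> (nat (int i - 1))) =
        cnj (\<alpha> (nat (int i - 1))) * (\<alpha> i * prod_list (map (step_weight \<alpha> (int i)) L))"
      using conjunct2[OF compare[of "int i"]] i by simp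
    then have "\<alpha> i * prod_list (map (step_weight \<alpha> (int i)) L) = 1"
      using nz[of "nat (int i - 1)"] i by simp
    moreover have "int i \<le> int i + h" if "(b, h) \<in> set L" for b h
    proof -
      have "(b, h) \<in> set (steps cs)"
        using that unfolding L_def by (meson notin_set_remove1)
      then show ?thesis
        using nonneg by fastforce
    qed
    ultimately show ?thesis
      using nz i by (intro reciprocal_eq_prod_list) auto
  qed
qed

end
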